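(* There exists a universal constant $C$ (independent of $\omega$) such that for every $\omega\in\mathbb{R}\setminus\mathbb{Q}$, $$\log R(\omega)\ \ge\ -B(\omega)-C .$$
   Context: For $\omega\in\mathbb{R}\setminus\mathbb{Q}$ put $\lambda=e^{2\pi i\omega}$. Let $\mathbb{D}=\{z\in\mathbb{C}: |z|<1\}$ and let $S_\lambda$ be the space of functions $F$ analytic and injective on $\mathbb{D}$ with $F(0)=0$ and $F'(0)=\lambda$. For $F\in S_\lambda$, let $H_F\in z\mathbb{C}[[z]]$ be the unique formal power series tangent to the identity ($H_F(z)=z+\sum_{n\ge2}h_nz^n$) satisfying $F\circ H_F=H_F\circ R_\lambda$, where $R_\lambda(z)=\lambda z$ (it exists and is unique since $\lambda$ is not a root of unity). Let $R(F)\in[0,+\infty]$ be the radius of convergence of $H_F$, and set $R(\omega)=\inf_{F\in S_\lambda}R(F)$ (with $\log 0=-\infty$). Continued fractions: $a_0=\lfloor\omega\rfloor$, $\omega_0=\omega-\lfloor\omega\rfloor$, and for $n\ge1$, $a_n=\lfloor 1/\omega_{n-1}\rfloor$, $\omega_n=1/\omega_{n-1}-a_n$. The denominators of the convergents of $\omega$ are defined by $q_{-2}=1$, $q_{-1}=0$, $q_n=a_nq_{n-1}+q_{n-2}$ for $n\ge0$. The Brjuno function is $B(\omega)=\sum_{n\ge0}\frac{\log q_{n+1}}{q_n}\in[0,+\infty]$. *)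

theory Defs
  imports "HOL-Complex_Analysis.Complex_Analysis"
begin

definition multiplier :: "real \<Rightarrow> complex" where
  "multiplier \<omega> = exp (2 * of_real pi * \<i> * of_real \<omega>)"

(* Only the values on the open unit disk matter; what F does elsewhere is unconstrained
   and does not affect its Taylor series at 0. *)
definition univalent_class :: "complex \<Rightarrow> (complex \<Rightarrow> complex) set" where
  "univalent_class l =
     {F. F analytic_on ball 0 1 \<and> inj_on F (ball 0 1) \<and> F 0 = 0 \<and> deriv F 0 = l}"

definition linearizes :: "complex \<Rightarrow> complex fps \<Rightarrow> complex fps \<Rightarrow> bool" where
  "linearizes l f H \<longleftrightarrow>
     fps_nth H 0 = 0 \<and> fps_nth H 1 = 1 \<and>
     fps_compose f H = fps_compose H (fps_const l * fps_X)"

(* The description is proper for f(0) = 0, f'(0) = l with l nonzero and not a root of unity;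
   see linearization_exists_unique and linearizes_linearization below. *)
definition linearization :: "complex \<Rightarrow> (complex \<Rightarrow> complex) \<Rightarrow> complex fps" where
  "linearization l F = (THE H. linearizes l (fps_expansion F 0) H)"

definition lin_radius :: "complex \<Rightarrow> (complex \<Rightarrow> complex) \<Rightarrow> ereal" where
  "lin_radius l F = fps_conv_radius (linearization l F)"

definition inf_lin_radius :: "real \<Rightarrow> ereal" where
  "inf_lin_radius \<omega> = (INF F\<in>univalent_class (multiplier \<omega>). lin_radius (multiplier \<omega>) F)"

(* Extended logarithm on [0, \<infinity>], with log 0 = -\<infinity> and log \<infinity> = \<infinity>;
   negative arguments are immaterial. *)
definition ereal_log :: "ereal \<Rightarrow> ereal" where
  "ereal_log r =
     (if r \<le> 0 then -\<infinity> else if r = \<infinity> then \<infinity> else ereal (ln (real_of_ereal r)))"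

primrec cf_rem :: "real \<Rightarrow> nat \<Rightarrow> real" where
  "cf_rem \<omega> 0 = \<omega> - of_int \<lfloor>\<omega>\<rfloor>"
| "cf_rem \<omega> (Suc n) = 1 / cf_rem \<omega> n - of_int \<lfloor>1 / cf_rem \<omega> n\<rfloor>"

fun cf_coeff :: "real \<Rightarrow> nat \<Rightarrow> int" where
  "cf_coeff \<omega> 0 = \<lfloor>\<omega>\<rfloor>"
| "cf_coeff \<omega> (Suc n) = \<lfloor>1 / cf_rem \<omega> n\<rfloor>"

(* The index is shifted by 2: cf_denom_aux w m is q_(m-2). *)
fun cf_denom_aux :: "real \<Rightarrow> nat \<Rightarrow> int" where
  "cf_denom_aux \<omega> 0 = 1"
| "cf_denom_aux \<omega> (Suc 0) = 0"
| "cf_denom_aux \<omega> (Suc (Suc n)) =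
     cf_coeff \<omega> n * cf_denom_aux \<omega> (Suc n) + cf_denom_aux \<omega> n"

definition cf_denom :: "real \<Rightarrow> nat \<Rightarrow> int" where
  "cf_denom \<omega> n = cf_denom_aux \<omega> (n + 2)"

(* For irrational w all q_n are at least 1, so the terms are nonnegative and
   the sum exists in [0, \<infinity>]. *)
definition brjuno :: "real \<Rightarrow> ereal" where
  "brjuno \<omega> = (\<Sum>n. ereal (ln (of_int (cf_denom \<omega> (n + 1))) / of_int (cf_denom \<omega> n)))"


lemma multiplier_power_neq_1:
  assumes "\<omega> \<notin> \<rat>" "n > 0"
  shows "multiplier \<omega> ^ n \<noteq> 1"
proof
  assume "multiplier \<omega> ^ n = 1"
  hence "exp (of_nat n * (2 * of_real pi * \<i> * of_real \<omega>)) = (1::complex)"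
    by (simp add: multiplier_def exp_of_nat_mult)
  then obtain k :: int where "real n * (2 * pi * \<omega>) = of_int (2 * k) * pi"
    by (auto simp: exp_eq_1)
  hence "\<omega> = of_int k / of_nat n"
    using assms(2) by (simp add: field_simps)
  hence "\<omega> \<in> \<rat>" by simp
  with assms(1) show False by simp
qed

lemma fps_power_nth_cong:
  fixes A B :: "'a::comm_ring_1 fps"
  assumes "\<And>k. k \<le> m \<Longrightarrow> fps_nth A k = fps_nth B k"
  shows "fps_nth (A ^ j) m = fps_nth (B ^ j) m"
  using assms
proof (induction j arbitrary: m)
  case (Suc j)
  have "fps_nth A k * fps_nth (A ^ j) (m - k) = fps_nth B k * fps_nth (B ^ j) (m - k)"
    if "k \<in> {0..m}" for k
    using that Suc.prems Suc.IH[of "m - k"] by auto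
  thus ?case unfolding power_Suc fps_mult_nth by (intro sum.cong refl)
qed simp

lemma fps_power_nth_cong_less:
  fixes A B :: "'a::comm_ring_1 fps"
  assumes "\<And>k. k < n \<Longrightarrow> fps_nth A k = fps_nth B k"
    and "fps_nth A 0 = 0" "fps_nth B 0 = 0" and "i \<ge> 2"
  shows "fps_nth (A ^ i) n = fps_nth (B ^ i) n"
proof -
  from \<open>i \<ge> 2\<close> obtain j where i: "i = Suc j" "j > 0" by (cases i) auto
  have "fps_nth A k * fps_nth (A ^ j) (n - k) = fps_nth B k * fps_nth (B ^ j) (n - k)"
    if k: "k \<in> {0..n}" for k
  proof -
    consider "k = 0" | "k = n" | "0 < k" "k < n" using k by fastforce
    thus ?thesis
    proof cases
      case 2
      thus ?thesis using assms(2,3) i(2) by (simp add: fps_power_zeroth zero_power)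
    next
      case 3
      have "fps_nth (A ^ j) (n - k) = fps_nth (B ^ j) (n - k)"
        by (rule fps_power_nth_cong) (use assms(1) 3 in auto)
      thus ?thesis using assms(1) 3 by simp
    qed (use assms(2,3) in auto)
  qed
  thus ?thesis unfolding i power_Suc fps_mult_nth by (intro sum.cong refl)
qed

fun lin_coeff :: "complex \<Rightarrow> complex fps \<Rightarrow> nat \<Rightarrow> complex" where
  "lin_coeff l f n =
     (if n < 2 then of_nat n
      else (\<Sum>i=2..n. fps_nth f i * fps_nth (Abs_fps (\<lambda>k. if k < n then lin_coeff l f k else 0) ^ i) n)
             / (l ^ n - l))"

declare lin_coeff.simps [simp del]

lemma lin_coeff_0_1: "lin_coeff l f 0 = 0" "lin_coeff l f (Suc 0) = 1"
  by (subst lin_coeff.simps, simp)+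

lemma linearizes_iff:
  assumes "fps_nth f 0 = 0" "fps_nth f 1 = l"
  shows "linearizes l f H \<longleftrightarrow> fps_nth H 0 = 0 \<and> fps_nth H 1 = 1 \<and>
           (\<forall>n\<ge>2. (l ^ n - l) * fps_nth H n = (\<Sum>i=2..n. fps_nth f i * fps_nth (H ^ i) n))"
proof -
  have L: "fps_nth (fps_compose f H) n = l * fps_nth H n + (\<Sum>i=2..n. fps_nth f i * fps_nth (H ^ i) n)"
    if "n \<ge> 2" for n
  proof -
    have "{0..n} = insert 0 (insert 1 {2..n})" using that by auto
    thus ?thesis using assms by (simp add: fps_compose_nth)
  qed
  have R: "fps_nth (fps_compose H (fps_const l * fps_X)) n = l ^ n * fps_nth H n" for n
    by (simp add: fps_compose_linear)
  have "fps_compose f H = fps_compose H (fps_const l * fps_X) \<longleftrightarrow>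
        (\<forall>n\<ge>2. (l ^ n - l) * fps_nth H n = (\<Sum>i=2..n. fps_nth f i * fps_nth (H ^ i) n))"
    if "fps_nth H 0 = 0" "fps_nth H 1 = 1"
  proof -
    have "fps_nth (fps_compose f H) n = fps_nth (fps_compose H (fps_const l * fps_X)) n"
      if "n < 2" for n
    proof -
      from that have "n = 0 \<or> n = 1" by auto
      thus ?thesis
        using assms \<open>fps_nth H 0 = 0\<close> \<open>fps_nth H 1 = 1\<close> unfolding R by (auto simp: fps_compose_nth)
    qed
    hence "fps_compose f H = fps_compose H (fps_const l * fps_X) \<longleftrightarrow>
        (\<forall>n\<ge>2. fps_nth (fps_compose f H) n = fps_nth (fps_compose H (fps_const l * fps_X)) n)"
      by (metis fps_ext not_le)
    moreover have "l * x + S = l ^ n * x \<longleftrightarrow> (l ^ n - l) * x = S" for n x S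
      by (auto simp: algebra_simps)
    ultimately show ?thesis unfolding R by (simp add: L)
  qed
  thus ?thesis unfolding linearizes_def by blast
qed

theorem linearization_exists_unique:
  assumes "fps_nth f 0 = 0" "fps_nth f 1 = l" "l \<noteq> 0" "\<And>n. n > 0 \<Longrightarrow> l ^ n \<noteq> 1"
  shows "\<exists>!H. linearizes l f H"
proof -
  have ne: "l ^ n - l \<noteq> 0" if "n \<ge> 2" for n
  proof -
    have "l ^ n = l * l ^ (n - 1)" using that by (cases n) auto
    thus ?thesis using assms(3) assms(4)[of "n - 1"] that by auto
  qed
  define H where "H = Abs_fps (lin_coeff l f)"
  have "linearizes l f H"
    unfolding linearizes_iff[OF assms(1,2)]
  proof (intro conjI allI impI)
    show "fps_nth H 0 = 0" "fps_nth H 1 = 1" by (simp_all add: H_def lin_coeff_0_1)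
    fix n :: nat assume n: "n \<ge> 2"
    have "fps_nth (Abs_fps (\<lambda>k. if k < n then lin_coeff l f k else 0) ^ i) n = fps_nth (H ^ i) n"
      if "i \<in> {2..n}" for i
      by (rule fps_power_nth_cong_less) (use that n in \<open>auto simp: H_def lin_coeff_0_1\<close>)
    moreover have "fps_nth H n = (\<Sum>i=2..n. fps_nth f i *
        fps_nth (Abs_fps (\<lambda>k. if k < n then lin_coeff l f k else 0) ^ i) n) / (l ^ n - l)"
      unfolding H_def fps_nth_Abs_fps by (subst lin_coeff.simps) (use n in simp)
    ultimately show "(l ^ n - l) * fps_nth H n = (\<Sum>i=2..n. fps_nth f i * fps_nth (H ^ i) n)"
      using ne[OF n] by simp
  qed
  moreover have "A = B" if A: "linearizes l f A" and B: "linearizes l f B" for A B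
  proof (rule fps_ext)
    have A': "fps_nth A 0 = 0" "fps_nth A 1 = 1"
      using A unfolding linearizes_def by blast+
    have A2: "(l ^ n - l) * fps_nth A n = (\<Sum>i=2..n. fps_nth f i * fps_nth (A ^ i) n)" if "n \<ge> 2" for n
      using A that unfolding linearizes_iff[OF assms(1,2)] by blast
    have B': "fps_nth B 0 = 0" "fps_nth B 1 = 1"
      using B unfolding linearizes_def by blast+
    have B2: "(l ^ n - l) * fps_nth B n = (\<Sum>i=2..n. fps_nth f i * fps_nth (B ^ i) n)" if "n \<ge> 2" for n
      using B that unfolding linearizes_iff[OF assms(1,2)] by blast
    fix n show "fps_nth A n = fps_nth B n"
    proof (induction n rule: less_induct)
      case (less n)
      show ?case
      proof (cases "n \<ge> 2")
        case True
        have "fps_nth (A ^ i) n = fps_nth (B ^ i) n" if "i \<in> {2..n}" for i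
          by (rule fps_power_nth_cong_less) (use that A'(1) B'(1) less in auto)
        hence "(l ^ n - l) * fps_nth A n = (l ^ n - l) * fps_nth B n"
          unfolding A2[OF True] B2[OF True] by (intro sum.cong refl) simp
        thus ?thesis using ne[OF True] by simp
      next
        case False
        hence "n = 0 \<or> n = 1" by auto
        thus ?thesis using A' B' by auto
      qed
    qed
  qed
  ultimately show ?thesis by blast
qed

corollary linearizes_linearization:
  assumes "\<omega> \<notin> \<rat>" "F \<in> univalent_class (multiplier \<omega>)"
  shows "linearizes (multiplier \<omega>) (fps_expansion F 0) (linearization (multiplier \<omega>) F)"
  unfolding linearization_def
proof (rule theI', rule linearization_exists_unique)
  show "multiplier \<omega> ^ n \<noteq> 1" if "n > 0" for n
    using multiplier_power_neq_1[OF assms(1) that] .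
qed (use assms(2) in \<open>simp_all add: univalent_class_def fps_expansion_def multiplier_def\<close>)

lemma cf_rem_bounds:
  assumes "\<omega> \<notin> \<rat>"
  shows "cf_rem \<omega> n \<notin> \<rat> \<and> 0 < cf_rem \<omega> n \<and> cf_rem \<omega> n < 1"
proof -
  have *: "x - of_int \<lfloor>x\<rfloor> \<notin> \<rat> \<and> 0 < x - of_int \<lfloor>x\<rfloor> \<and> x - of_int \<lfloor>x\<rfloor> < 1"
    if x: "x \<notin> \<rat>" for x :: real
  proof -
    have "x - of_int \<lfloor>x\<rfloor> \<notin> \<rat>"
      using Rats_add[OF _ Rats_of_int, of "x - of_int \<lfloor>x\<rfloor>" "\<lfloor>x\<rfloor>"] x by auto
    moreover from this have "x - of_int \<lfloor>x\<rfloor> \<noteq> 0" by auto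
    ultimately show ?thesis by linarith
  qed
  show ?thesis
  proof (induction n)
    case (Suc n)
    have "1 / cf_rem \<omega> n \<notin> \<rat>"
      using Suc Rats_divide[OF Rats_1, of "1 / cf_rem \<omega> n"] by auto
    from *[OF this] show ?case by simp
  qed (use *[OF assms] in simp)
qed

lemma cf_denom_ge_1:
  assumes "\<omega> \<notin> \<rat>"
  shows "cf_denom \<omega> n \<ge> 1"
proof -
  have a: "cf_coeff \<omega> (Suc n) \<ge> 1" for n
    using cf_rem_bounds[OF assms, of n] by (simp add: le_floor_iff field_simps)
  have "cf_denom_aux \<omega> (Suc (Suc n)) \<ge> 1 \<and> cf_denom_aux \<omega> (Suc n) \<ge> 0" for n
  proof (induction n)
    case (Suc n)
    have "1 * 1 \<le> cf_coeff \<omega> (Suc n) * cf_denom_aux \<omega> (Suc (Suc n))"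
      by (rule mult_mono) (use a[of n] Suc in \<open>simp_all del: cf_coeff.simps\<close>)
    thus ?case using Suc by simp
  qed simp
  thus ?thesis by (simp add: cf_denom_def)
qed

end

theory Submission
  imports Defs
begin

text \<open>
  Write $F(z) = \lambda z + \sum_{m \ge 2} f_m z^m$ and $H_F(z) = \sum_{n \ge 1} h_n z^n$. The
  conjugacy equation determines $h$ recursively:
  $\lambda (\lambda^{n-1} - 1) h_n = \sum_{m=2}^n f_m \sum_{n_1 + \cdots + n_m = n} h_{n_1} \cdots h_{n_m}$.
  Three ingredients turn this into a lower bound for the radius of convergence.

  \<^item> The coefficients $f_m$ grow at most geometrically, uniformly over all univalent $F$
    normalised as here: such an $F$ omits a value $w$ of modulus at most $1$, and injectivity makes a square root of $1 - F/w$ omit two values, so that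
    Schottky's theorem bounds it (\<open>univalent_bounded_half_disc\<close>).

  \<^item> The small divisors are absorbed by a superadditive weight $K$. If
    $K(m) + K(n) \le K(m + n)$ and $|\lambda^n - 1| \ge e^{K(n-1) - K(n)}$, then the numbers
    $|h_{n+1}| e^{-K(n)}$ are dominated by the same recursion without any divisors, because the
    factors $e^{K(n_i - 1)}$ multiply to at most $e^{K(n-m)}$. They therefore grow geometrically
    (\<open>linearization_coeff_bound\<close>). If $K(n) \le \kappa n$, this gives
    $\log R(F) \ge -\kappa - C$.

  \<^item> A weight with $\kappa = B(\omega) + C$ exists (\<open>brjuno_weight_exists\<close>). This is a
    form of Davie's lemma. For each $k$ there is a superadditive function $g_k$ that jumps by $1$ at
    every $n$ for which $n\omega$ lies within $1/(8 q_k)$ of an integer, and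
    $g_k(n) \le n (1/q_k + 4/q_{k+1})$. With
    $K(n) = n \log 2 + \sum_k g_k(n) \log(2 q_{k+1})$ the main part of $K(n)/n$ is $B(\omega)$ with
    coefficient exactly $1$; the remaining terms are bounded because $q_k$ grows exponentially.

  When $B(\omega) = \infty$ the inequality holds trivially.
\<close>

section \<open>Coefficients of univalent functions\<close>

text \<open>
  Otherwise the image contains the closed unit disc, and the inverse function maps the open disc
  into itself with a derivative of modulus $1$ at the fixed point $0$. By the Schwarz lemma it is a
  rotation, which contradicts the fact that it maps the closed disc, being compact, into a strictly
  smaller one.
\<close>

lemma univalent_omits_value:
  assumes hol: "f holomorphic_on ball 0 1" and inj: "inj_on f (ball 0 1)"
    and f0: "f 0 = 0" and df: "cmod (deriv f 0) = 1"
  shows "\<exists>w. cmod w \<le> 1 \<and> w \<notin> f ` ball 0 1"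
proof (rule ccontr)
  assume "\<not> ?thesis"
  hence sub: "cball 0 1 \<subseteq> f ` ball 0 1"
    by auto
  obtain g where g: "g holomorphic_on f ` ball 0 1"
      and dg: "\<And>z. z \<in> ball 0 1 \<Longrightarrow> deriv f z * deriv g (f z) = 1"
      and gf: "\<And>z. z \<in> ball 0 1 \<Longrightarrow> g (f z) = z"
    using holomorphic_has_inverse[OF hol open_ball inj] by metis
  have norm_g: "cmod (g y) < 1" if "cmod y \<le> 1" for y
    using sub gf that by (force simp: subset_iff image_iff)
  have g0: "g 0 = 0"
    using gf[of 0] f0 by simp
  have "cmod (deriv f 0 * deriv g 0) = 1"
    using dg[of 0] f0 by simp
  hence "cmod (deriv g 0) = 1"
    using df by (simp add: norm_mult)
  moreover have "g holomorphic_on ball 0 1"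
    using g sub by (meson ball_subset_cball holomorphic_on_subset subset_trans)
  ultimately obtain \<alpha> where \<alpha>: "\<And>z. cmod z < 1 \<Longrightarrow> g z = \<alpha> * z" "cmod \<alpha> = 1"
    using Schwarz_Lemma(3)[of g 0] g0 norm_g by auto
  have "continuous_on (cball 0 1) (\<lambda>z. cmod (g z))"
    using holomorphic_on_imp_continuous_on[OF holomorphic_on_subset[OF g sub]]
    by (rule continuous_on_norm)
  then obtain z0 :: complex where z0: "cmod z0 \<le> 1" "\<And>z. cmod z \<le> 1 \<Longrightarrow> cmod (g z) \<le> cmod (g z0)"
    using continuous_attains_sup[of "cball (0::complex) 1" "\<lambda>z. cmod (g z)"] by auto
  define s where "s = (1 + cmod (g z0)) / 2"
  have s: "cmod (g z0) < s" "s < 1" "0 \<le> s"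
    using norm_g[OF z0(1)] by (simp_all add: s_def)
  have "cmod (g (of_real s)) = s"
    using \<alpha> s by (simp add: norm_mult)
  thus False
    using z0(2)[of "of_real s"] s by simp
qed

text \<open>
  The square is that of the bound in Schottky's theorem for functions that omit $0$ and $1$ and have
  modulus $1$ at the centre, at the relative radius $2/3$: indeed $2 + 2 + 12 \cdot 2 = 28$.
\<close>

definition univalent_bound :: real where
  "univalent_bound = 1 + (exp (pi * exp (pi * 28)))\<^sup>2"

text \<open>
  If \<open>f\<close> omits \<open>w\<close>, then \<open>1 - f / w\<close> has a holomorphic square root
  \<open>k\<close>, normalised by \<open>k 0 = - 1\<close>. It omits $0$, and it also omits $1$: where
  \<open>k = 1\<close>, the value of \<open>f\<close> is \<open>0 = f 0\<close>, and by injectivity this happens at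
  the origin only, where \<open>k\<close> is $-1$. Schottky's theorem bounds \<open>k\<close>, hence
  \<open>f\<close>.
\<close>

lemma univalent_bounded_half_disc:
  assumes hol: "f holomorphic_on ball 0 1" and inj: "inj_on f (ball 0 1)"
    and f0: "f 0 = 0" and df: "cmod (deriv f 0) = 1" and z: "cmod z \<le> 1/2"
  shows "cmod (f z) \<le> univalent_bound"
proof -
  obtain w where w: "cmod w \<le> 1" "w \<notin> f ` ball 0 1"
    using univalent_omits_value[OF hol inj f0 df] by blast
  have w0: "w \<noteq> 0"
    using w(2) f0 by (metis centre_in_ball image_eqI zero_less_one)
  have "(\<lambda>z. 1 - f z / w) holomorphic_on ball 0 1"
    by (intro holomorphic_intros hol) (use w0 in auto)
  moreover have "1 - f z / w \<noteq> 0" if "z \<in> ball 0 1" for z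
    using w(2) w0 that by auto
  ultimately obtain g where g: "g holomorphic_on ball 0 1"
      and g2: "\<And>z. z \<in> ball 0 1 \<Longrightarrow> 1 - f z / w = (g z)\<^sup>2"
    by (rule contractible_imp_holomorphic_sqrt[OF _ convex_imp_contractible[OF convex_ball]])
       (assumption, rule that)
  have g0: "(g 0)\<^sup>2 = 1"
    using g2[of 0] f0 by simp
  hence "g 0 \<noteq> 0" by auto
  define k where "k = (\<lambda>z. - g z / g 0)"
  have k2: "(k z)\<^sup>2 = 1 - f z / w" if "cmod z < 1" for z
    using g2[of z] that g0 by (simp add: k_def power_divide)
  have holk: "k holomorphic_on ball 0 1"
    unfolding k_def by (intro holomorphic_intros g \<open>g 0 \<noteq> 0\<close>)
  have k0: "k 0 = -1"
    using \<open>g 0 \<noteq> 0\<close> by (simp add: k_def)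
  have k_omits: "k z \<noteq> 0 \<and> k z \<noteq> 1" if "cmod z < 1" for z
  proof (intro conjI notI)
    assume "k z = 0"
    hence "f z = w"
      using k2[OF that] w0 by simp
    thus False
      using w(2) that by auto
  next
    assume kz: "k z = 1"
    hence "f z = f 0"
      using k2[OF that] w0 f0 by simp
    hence "z = 0"
      using inj that by (auto simp: inj_on_def)
    thus False
      using kz k0 by simp
  qed
  \<comment> \<open>Schottky's theorem asks for holomorphy on the closed unit disc, so \<open>k\<close> is used on the
      disc of radius \<open>3/4\<close>; the half disc then has relative radius \<open>2/3\<close>.\<close>
  have "cmod (k (3/4 * (4/3 * z))) \<le> exp (pi * exp (pi * (2 + 2 * 1 + 12 * (2/3) / (1 - 2/3))))"
  proof (rule Schottky[where f = "\<lambda>z. k (3/4 * z)" and z = "4/3 * z"])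
    have "(k \<circ> (\<lambda>z. 3/4 * z)) holomorphic_on cball 0 1"
      by (rule holomorphic_on_compose_gen[OF _ holk])
         (auto intro!: holomorphic_intros simp: norm_mult)
    thus "(\<lambda>z. k (3/4 * z)) holomorphic_on cball 0 1"
      by (simp add: o_def)
    show "\<not> (k (3/4 * z) = 0 \<or> k (3/4 * z) = 1)" if "z \<in> cball 0 1" for z
      using k_omits[of "3/4 * z"] that by (simp add: norm_mult)
    show "cmod (4/3 * z) \<le> 2/3"
      using z by (simp add: norm_mult norm_divide)
  qed (use k0 in auto)
  hence kz: "cmod (k z) \<le> exp (pi * exp (pi * 28))"
    by simp
  have "f z = w * (1 - (k z)\<^sup>2)"
    using k2[of z] z w0 by simp
  hence "cmod (f z) = cmod w * cmod (1 - (k z)\<^sup>2)"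
    by (simp add: norm_mult)
  also have "\<dots> \<le> 1 * (1 + (cmod (k z))\<^sup>2)"
    using w(1) norm_triangle_ineq4[of 1 "(k z)\<^sup>2"]
    by (intro mult_mono) (simp_all add: norm_power)
  also have "\<dots> \<le> univalent_bound"
    using power_mono[OF kz, of 2] by (simp add: univalent_bound_def)
  finally show ?thesis .
qed

lemma univalent_coeff_bound:
  assumes hol: "f holomorphic_on ball 0 1" and inj: "inj_on f (ball 0 1)"
    and f0: "f 0 = 0" and df: "cmod (deriv f 0) = 1"
  shows "cmod (fps_nth (fps_expansion f 0) n) \<le> univalent_bound * 2 ^ n"
proof -
  have "cmod ((deriv ^^ n) f 0) \<le> fact n * univalent_bound / (1/2) ^ n"
  proof (rule Cauchy_inequality)
    show "f holomorphic_on ball 0 (1/2)"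
      by (rule holomorphic_on_subset[OF hol]) auto
    show "continuous_on (cball 0 (1/2)) f"
      by (rule holomorphic_on_imp_continuous_on, rule holomorphic_on_subset[OF hol]) auto
  qed (use univalent_bounded_half_disc[OF hol inj f0 df] in auto)
  thus ?thesis
    by (simp add: fps_expansion_def norm_divide field_simps)
qed

section \<open>Majorants for the linearisation in the presence of small divisors\<close>

lemma sum_fps_mult_nth_le:
  fixes A B :: "real fps"
  assumes "\<And>i. fps_nth A i \<ge> 0" "\<And>i. fps_nth B i \<ge> 0" "r \<ge> 0"
  shows "(\<Sum>n\<le>N. fps_nth (A * B) n * r ^ n) \<le> (\<Sum>n\<le>N. fps_nth A n * r ^ n) * (\<Sum>n\<le>N. fps_nth B n * r ^ n)"
proof -
  have "(\<Sum>n\<le>N. fps_nth (A * B) n * r ^ n)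
      = (\<Sum>n\<le>N. \<Sum>i\<le>n. fps_nth A i * r ^ i * (fps_nth B (n - i) * r ^ (n - i)))"
  proof (rule sum.cong[OF refl])
    fix n
    have "r ^ n = r ^ i * r ^ (n - i)" if "i \<le> n" for i
      using that by (simp flip: power_add)
    thus "fps_nth (A * B) n * r ^ n = (\<Sum>i\<le>n. fps_nth A i * r ^ i * (fps_nth B (n - i) * r ^ (n - i)))"
      unfolding fps_mult_nth sum_distrib_right atMost_atLeast0 by (intro sum.cong) simp_all
  qed
  also have "\<dots> = (\<Sum>(n,i)\<in>(SIGMA n:{..N}. {..n}). fps_nth A i * r ^ i * (fps_nth B (n - i) * r ^ (n - i)))"
    by (subst sum.Sigma) auto
  also have "\<dots> \<le> (\<Sum>(i,k)\<in>{..N}\<times>{..N}. fps_nth A i * r ^ i * (fps_nth B k * r ^ k))"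
    by (rule sum_le_included[where i = "\<lambda>(i,k). (i + k, i)"]) (use assms in \<open>force+\<close>)
  also have "\<dots> = (\<Sum>n\<le>N. fps_nth A n * r ^ n) * (\<Sum>n\<le>N. fps_nth B n * r ^ n)"
    by (simp add: sum_product sum.cartesian_product)
  finally show ?thesis .
qed

lemma fps_power_nth_nonneg:
  fixes A :: "real fps"
  assumes "\<And>i. fps_nth A i \<ge> 0"
  shows "fps_nth (A ^ m) n \<ge> 0"
  by (induction m arbitrary: n) (auto simp: fps_mult_nth assms intro!: sum_nonneg)

lemma sum_fps_power_nth_le:
  fixes A :: "real fps"
  assumes "\<And>i. fps_nth A i \<ge> 0" "r \<ge> 0"
  shows "(\<Sum>n\<le>N. fps_nth (A ^ m) n * r ^ n) \<le> (\<Sum>n\<le>N. fps_nth A n * r ^ n) ^ m"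
proof (induction m)
  case (Suc m)
  have "(\<Sum>n\<le>N. fps_nth (A ^ Suc m) n * r ^ n)
      \<le> (\<Sum>n\<le>N. fps_nth A n * r ^ n) * (\<Sum>n\<le>N. fps_nth (A ^ m) n * r ^ n)"
    unfolding power_Suc by (intro sum_fps_mult_nth_le fps_power_nth_nonneg assms)
  also have "\<dots> \<le> (\<Sum>n\<le>N. fps_nth A n * r ^ n) ^ Suc m"
    unfolding power_Suc by (intro mult_left_mono Suc.IH sum_nonneg) (simp add: assms)
  finally show ?case .
next
  case 0
  have "(\<Sum>n\<le>N. fps_nth 1 n * r ^ n) = (\<Sum>n\<le>N. if n = 0 then 1 else 0)"
    by (intro sum.cong) auto
  thus ?case by simp
qed

text \<open>
  With $r = 1/(8b)$ let $s_N = \sum_{i \le N} u_i r^i$. The bound for $u_i$ only involves earlier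
  coefficients, so $s_{N+1} \le 1 + \sum_{j \ge 1} (br)^j s_N^{j+1}$, and $s_N \le 2$ gives
  $s_{N+1} \le 1 + 2 \sum_{j \ge 1} 4^{-j} < 2$.
\<close>

lemma majorant_partial_sums:
  fixes U :: "real fps"
  assumes U0: "fps_nth U 0 \<le> 1" and nonneg: "\<And>i. fps_nth U i \<ge> 0" and b: "b > 0"
    and rec: "\<And>i. i \<ge> 1 \<Longrightarrow> fps_nth U i \<le> (\<Sum>j=1..i. b ^ j * fps_nth (U ^ Suc j) (i - j))"
  shows "(\<Sum>i\<le>N. fps_nth U i * (1 / (8 * b)) ^ i) \<le> 2"
proof (induction N)
  case 0
  thus ?case using U0 by simp
next
  case (Suc N)
  define r where "r = 1 / (8 * b)"
  have r: "r > 0" "b * r = 1 / 8" using b by (simp_all add: r_def)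
  define s where "s = (\<Sum>i\<le>N. fps_nth U i * r ^ i)"
  have s: "0 \<le> s" "s \<le> 2"
    using Suc nonneg r by (auto simp: s_def r_def intro!: sum_nonneg)
  have Upos: "fps_nth (U ^ m) n \<ge> 0" for m n
    by (rule fps_power_nth_nonneg[OF nonneg])
  have "(\<Sum>i=1..Suc N. fps_nth U i * r ^ i)
      \<le> (\<Sum>i=1..Suc N. \<Sum>j=1..i. (b * r) ^ j * (fps_nth (U ^ Suc j) (i - j) * r ^ (i - j)))"
  proof (rule sum_mono)
    fix i assume i: "i \<in> {1..Suc N}"
    have "fps_nth U i * r ^ i \<le> (\<Sum>j=1..i. b ^ j * fps_nth (U ^ Suc j) (i - j)) * r ^ i"
      using rec[of i] i r by (intro mult_right_mono) auto
    also have "\<dots> = (\<Sum>j=1..i. (b * r) ^ j * (fps_nth (U ^ Suc j) (i - j) * r ^ (i - j)))"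
      unfolding sum_distrib_right
    proof (rule sum.cong[OF refl])
      fix j assume "j \<in> {1..i}"
      hence "r ^ i = r ^ j * r ^ (i - j)" by (simp flip: power_add)
      thus "b ^ j * fps_nth (U ^ Suc j) (i - j) * r ^ i = (b * r) ^ j * (fps_nth (U ^ Suc j) (i - j) * r ^ (i - j))"
        by (simp add: power_mult_distrib)
    qed
    finally show "fps_nth U i * r ^ i \<le> \<dots>" .
  qed
  also have "\<dots> = (\<Sum>(i,j)\<in>(SIGMA i:{1..Suc N}. {1..i}). (b * r) ^ j * (fps_nth (U ^ Suc j) (i - j) * r ^ (i - j)))"
    by (subst sum.Sigma) auto
  \<comment> \<open>Interchange the two sums and enlarge the triangle of pairs \<open>(j, i - j)\<close> to a rectangle.\<close>
  also have "\<dots> \<le> (\<Sum>(j,l)\<in>{1..Suc N}\<times>{..N}. (b * r) ^ j * (fps_nth (U ^ Suc j) l * r ^ l))"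
  proof (rule sum_le_included[where i = "\<lambda>(j,l). (j + l, j)"])
    show "\<forall>y\<in>{1..Suc N} \<times> {..N}. 0 \<le> (case y of (j, l) \<Rightarrow> (b * r) ^ j * (fps_nth (U ^ Suc j) l * r ^ l))"
      using Upos r by (auto intro!: mult_nonneg_nonneg simp del: power_Suc)
    show "\<forall>x\<in>SIGMA i:{1..Suc N}. {1..i}. \<exists>y\<in>{1..Suc N} \<times> {..N}. (case y of (j, l) \<Rightarrow> (j + l, j)) = x \<and>
        (case x of (i, j) \<Rightarrow> (b * r) ^ j * (fps_nth (U ^ Suc j) (i - j) * r ^ (i - j)))
        \<le> (case y of (j, l) \<Rightarrow> (b * r) ^ j * (fps_nth (U ^ Suc j) l * r ^ l))"
    proof safe
      fix i j assume "i \<in> {1..Suc N}" "j \<in> {1..i}"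
      thus "\<exists>y\<in>{1..Suc N} \<times> {..N}. (case y of (j, l) \<Rightarrow> (j + l, j)) = (i, j) \<and>
        (b * r) ^ j * (fps_nth (U ^ Suc j) (i - j) * r ^ (i - j))
        \<le> (case y of (j, l) \<Rightarrow> (b * r) ^ j * (fps_nth (U ^ Suc j) l * r ^ l))"
        by (intro bexI[of _ "(j, i - j)"]) auto
    qed
  qed auto
  also have "\<dots> = (\<Sum>j=1..Suc N. (b * r) ^ j * (\<Sum>l\<le>N. fps_nth (U ^ Suc j) l * r ^ l))"
    by (simp add: sum_distrib_left sum.cartesian_product)
  also have "\<dots> \<le> (\<Sum>j=1..Suc N. (1 / 8) ^ j * 2 ^ Suc j)"
  proof (rule sum_mono)
    fix j
    have "(\<Sum>l\<le>N. fps_nth (U ^ Suc j) l * r ^ l) \<le> s ^ Suc j"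
      unfolding s_def by (rule sum_fps_power_nth_le) (use nonneg r in auto)
    also have "\<dots> \<le> 2 ^ Suc j"
      using s by (intro power_mono) auto
    finally show "(b * r) ^ j * (\<Sum>l\<le>N. fps_nth (U ^ Suc j) l * r ^ l) \<le> (1 / 8) ^ j * 2 ^ Suc j"
      unfolding r by (intro mult_left_mono) auto
  qed
  also have "\<dots> = 2 * (\<Sum>j=1..Suc N. (1/4) ^ j)"
  proof -
    have "(1/8) ^ j * 2 ^ Suc j = 2 * (1/4::real) ^ j" for j
      using power_mult_distrib[of "1/8::real" 2 j] by simp
    thus ?thesis by (simp only: sum_distrib_left)
  qed
  also have "(\<Sum>j=1..Suc N. (1/4) ^ j) \<le> (1/2::real)"
  proof -
    have "3 * (\<Sum>j=1..n. (1/4) ^ j) = (1 - (1/4) ^ n :: real)" for n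
    proof (induction n)
      case (Suc n)
      have "3 * (\<Sum>j=1..Suc n. (1/4) ^ j) = 3 * (\<Sum>j=1..n. (1/4) ^ j) + 3 * (1/4::real) ^ Suc n"
        by simp
      thus ?case unfolding Suc.IH by simp
    qed simp
    from this[of "Suc N"]
    have "3 * (\<Sum>j=1..Suc N. (1/4) ^ j) = (1 - (1/4) ^ Suc N :: real)" .
    moreover have "(0::real) \<le> (1/4) ^ Suc N" by simp
    ultimately show ?thesis by linarith
  qed
  finally have "(\<Sum>i=1..Suc N. fps_nth U i * r ^ i) \<le> 1"
    by simp
  moreover have "{..Suc N} = insert 0 {1..Suc N}"
    by auto
  ultimately have "(\<Sum>i\<le>Suc N. fps_nth U i * r ^ i) \<le> 2"
    using U0 by simp
  thus ?case by (simp add: r_def)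
qed

text \<open>
  Superadditivity in action: in a product of coefficients with total index \<open>n\<close> the weights
  multiply to at most \<open>exp (K n)\<close>, so that they can be pulled out of the power.
\<close>

lemma fps_power_nth_weight_le:
  fixes V :: "complex fps" and K :: "nat \<Rightarrow> real"
  assumes K0: "K 0 = 0" and super: "\<And>m n. K m + K n \<le> K (m + n)"
  defines "U \<equiv> Abs_fps (\<lambda>i. cmod (fps_nth V i) * exp (- K i))"
  shows "cmod (fps_nth (V ^ m) n) \<le> exp (K n) * fps_nth (U ^ m) n"
proof (induction m arbitrary: n)
  case 0
  show ?case using K0 by (simp add: fps_one_nth)
next
  case (Suc m)
  have Upos: "fps_nth (U ^ m) n \<ge> 0" for m n
    by (rule fps_power_nth_nonneg) (simp add: U_def)
  have "cmod (fps_nth (V ^ Suc m) n) \<le> (\<Sum>i=0..n. cmod (fps_nth V i * fps_nth (V ^ m) (n - i)))"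
    unfolding power_Suc fps_mult_nth by (rule norm_sum)
  also have "\<dots> \<le> (\<Sum>i=0..n. exp (K n) * (fps_nth U i * fps_nth (U ^ m) (n - i)))"
  proof (rule sum_mono)
    fix i assume i: "i \<in> {0..n}"
    have V: "cmod (fps_nth V i) = exp (K i) * fps_nth U i"
      by (simp add: U_def exp_minus)
    have "cmod (fps_nth V i * fps_nth (V ^ m) (n - i)) \<le>
        exp (K i) * fps_nth U i * (exp (K (n - i)) * fps_nth (U ^ m) (n - i))"
      unfolding norm_mult V by (intro mult_left_mono Suc.IH) (simp add: U_def)
    also have "\<dots> = exp (K i + K (n - i)) * (fps_nth U i * fps_nth (U ^ m) (n - i))"
      by (simp add: exp_add)
    also have "\<dots> \<le> exp (K n) * (fps_nth U i * fps_nth (U ^ m) (n - i))"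
      using super[of i "n - i"] i Upos[of 1 i] Upos[of m "n - i"] by (intro mult_right_mono) auto
    finally show "cmod (fps_nth V i * fps_nth (V ^ m) (n - i)) \<le> \<dots>" .
  qed
  also have "\<dots> = exp (K n) * fps_nth (U ^ Suc m) n"
    by (simp add: fps_mult_nth sum_distrib_left)
  finally show ?case .
qed

text \<open>
  The index shift is essential. With $H = z V$, a product of $m$ coefficients of $H$ with total index
  $n$ is a product of coefficients of $V$ with total index $n - m \le n - 2$. Its weight is at most
  $e^{K(n-2)}$, and the divisor $\lambda^{n-1} - 1$ raises this to $e^{K(n-1)}$, which is exactly the
  weight allotted to $h_n$.
\<close>

lemma linearization_coeff_bound:
  fixes f H :: "complex fps" and K :: "nat \<Rightarrow> real"
  assumes lin: "linearizes l f H" and f0: "fps_nth f 0 = 0" and f1: "fps_nth f 1 = l"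
    and l: "cmod l = 1" and b: "b > 0"
    and fb: "\<And>j. j \<ge> 1 \<Longrightarrow> cmod (fps_nth f (Suc j)) \<le> b ^ j"
    and K0: "K 0 = 0" and Kpos: "\<And>n. K n \<ge> 0" and super: "\<And>m n. K m + K n \<le> K (m + n)"
    and jump: "\<And>n. n \<ge> 1 \<Longrightarrow> exp (K (n - 1)) \<le> exp (K n) * cmod (l ^ n - 1)"
  shows "cmod (fps_nth H (Suc n)) \<le> 2 * (8 * b) ^ n * exp (K n)"
proof -
  define V where "V = fps_shift 1 H"
  define U where "U = Abs_fps (\<lambda>i. cmod (fps_nth V i) * exp (- K i))"
  have H: "fps_nth H 0 = 0" "fps_nth H 1 = 1"
    "\<And>n. n \<ge> 2 \<Longrightarrow> (l ^ n - l) * fps_nth H n = (\<Sum>i=2..n. fps_nth f i * fps_nth (H ^ i) n)"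
    using lin unfolding linearizes_iff[OF f0 f1] by auto
  have HV: "H = fps_X * V"
    using H(1) by (intro fps_ext) (auto simp: V_def)
  have Upos: "fps_nth (U ^ m) n \<ge> 0" for m n
    by (rule fps_power_nth_nonneg) (simp add: U_def)
  have Kmono: "K m \<le> K n" if "m \<le> n" for m n
    using super[of m "n - m"] Kpos[of "n - m"] that by simp
  have "(\<Sum>i\<le>n. fps_nth U i * (1 / (8 * b)) ^ i) \<le> 2"
  proof (rule majorant_partial_sums[OF _ _ b])
    show "fps_nth U 0 \<le> 1"
      using H(2) K0 by (simp add: U_def V_def)
    show "fps_nth U i \<ge> 0" for i
      by (simp add: U_def)
    fix i :: nat assume i: "i \<ge> 1"
    have "(l ^ Suc i - l) * fps_nth V i = (\<Sum>m=2..Suc i. fps_nth f m * fps_nth (H ^ m) (Suc i))"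
      using H(3)[of "Suc i"] i by (simp add: V_def)
    also have "\<dots> = (\<Sum>j=1..i. fps_nth f (Suc j) * fps_nth (H ^ Suc j) (Suc i))"
      unfolding numeral_2_eq_2 One_nat_def by (rule sum.shift_bounds_cl_Suc_ivl)
    also have "\<dots> = (\<Sum>j=1..i. fps_nth f (Suc j) * fps_nth (V ^ Suc j) (i - j))"
      by (intro sum.cong refl) (simp add: HV power_mult_distrib fps_X_power_mult_nth del: power_Suc)
    finally have eq: "(l ^ Suc i - l) * fps_nth V i = \<dots>" .
    have "cmod (l ^ i - 1) * cmod (fps_nth V i) = cmod l * cmod (l ^ i - 1) * cmod (fps_nth V i)"
      by (simp add: l)
    also have "\<dots> = cmod ((l ^ Suc i - l) * fps_nth V i)"
      by (simp add: norm_mult[symmetric] algebra_simps)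
    also have "\<dots> \<le> (\<Sum>j=1..i. cmod (fps_nth f (Suc j) * fps_nth (V ^ Suc j) (i - j)))"
      unfolding eq by (rule norm_sum)
    also have "\<dots> \<le> (\<Sum>j=1..i. exp (K (i - 1)) * (b ^ j * fps_nth (U ^ Suc j) (i - j)))"
    proof (rule sum_mono)
      fix j assume j: "j \<in> {1..i}"
      have "cmod (fps_nth (V ^ Suc j) (i - j)) \<le> exp (K (i - j)) * fps_nth (U ^ Suc j) (i - j)"
        unfolding U_def by (rule fps_power_nth_weight_le[OF K0 super])
      also have "\<dots> \<le> exp (K (i - 1)) * fps_nth (U ^ Suc j) (i - j)"
        using j Upos by (intro mult_right_mono) (auto intro!: Kmono simp del: power_Suc)
      finally have "cmod (fps_nth f (Suc j)) * cmod (fps_nth (V ^ Suc j) (i - j))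
          \<le> b ^ j * (exp (K (i - 1)) * fps_nth (U ^ Suc j) (i - j))"
        using fb[of j] j b by (intro mult_mono) auto
      thus "cmod (fps_nth f (Suc j) * fps_nth (V ^ Suc j) (i - j))
          \<le> exp (K (i - 1)) * (b ^ j * fps_nth (U ^ Suc j) (i - j))"
        by (simp add: norm_mult mult_ac)
    qed
    also have "\<dots> = exp (K (i - 1)) * (\<Sum>j=1..i. b ^ j * fps_nth (U ^ Suc j) (i - j))"
      by (simp add: sum_distrib_left)
    finally have 1: "cmod (l ^ i - 1) * cmod (fps_nth V i) \<le> \<dots>" .
    have "exp (K (i - 1)) * fps_nth U i \<le> exp (K i) * cmod (l ^ i - 1) * fps_nth U i"
      using jump[OF i] Upos[of 1 i] by (intro mult_right_mono) auto
    also have "\<dots> = cmod (l ^ i - 1) * cmod (fps_nth V i)"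
      by (simp add: U_def exp_minus)
    also note 1
    finally show "fps_nth U i \<le> (\<Sum>j=1..i. b ^ j * fps_nth (U ^ Suc j) (i - j))"
      by simp
  qed
  moreover have "fps_nth U n * (1 / (8 * b)) ^ n \<le> (\<Sum>i\<le>n. fps_nth U i * (1 / (8 * b)) ^ i)"
    using b by (intro member_le_sum) (auto simp: U_def)
  ultimately have "fps_nth U n * (1 / (8 * b)) ^ n \<le> 2"
    by linarith
  thus ?thesis
    using b by (simp add: U_def V_def exp_minus power_divide field_simps)
qed

section \<open>A superadditive count of small divisors\<close>

definition near_int :: "real \<Rightarrow> real \<Rightarrow> bool" where
  "near_int \<delta> x \<longleftrightarrow> (\<exists>m::int. \<bar>x - of_int m\<bar> \<le> \<delta>)"

text \<open>
  The function $g_k$ at $n$ is the supremum of the values below, with $q = q_k$ and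
  $q' = q_{k+1}$. Its jumps are to occur on
  $A = \{n : \mathrm{dist}(n\omega, \mathbf Z) \le 1/(8q)\}$, whose elements are multiples of $q$ as
  long as they are small compared with $q'$. The level \<open>t = 0\<close> counts multiples of $q$ up to
  $n$; the level \<open>t = 1\<close> starts from any $m \in A$ with the value $cm - 1$, where
  $c = 1/q + 4/q'$, and counts steps of length $q$ from there; the level \<open>t = 2\<close> allows any
  starting point $m$ at the price of one more unit. Two values of positive level add up to at
  most a value of level \<open>2\<close>, which is why the supremum is superadditive.
\<close>

definition davie_values :: "real \<Rightarrow> int \<Rightarrow> int \<Rightarrow> nat \<Rightarrow> real set" where
  "davie_values \<omega> q q' n =
     {(1 / of_int q + 4 / of_int q') * real m + real j - real t | m j t.
        int m + int j * q \<le> int n \<and>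
        (t = 0 \<and> m = 0 \<or> t = 1 \<and> near_int (1 / (8 * of_int q)) (real m * \<omega>) \<or> t = 2)}"

definition davie_count :: "real \<Rightarrow> int \<Rightarrow> int \<Rightarrow> nat \<Rightarrow> real" where
  "davie_count \<omega> q q' n = Sup (davie_values \<omega> q q' n)"

text \<open>
  Since $d p - m q = q (d\omega - m) - d (q\omega - p)$ is an integer of modulus at most
  $1/4 + d/q' < 1$, it vanishes, and $q$ divides $d$.
\<close>

lemma near_int_imp_dvd:
  assumes q: "q \<ge> 1" "q' \<ge> 1" and cop: "coprime p q"
    and appr: "\<bar>of_int q * \<omega> - of_int p\<bar> \<le> 1 / of_int q'"
    and near: "near_int (1 / (4 * of_int q)) (of_int d * \<omega>)"
    and d: "0 \<le> d" "2 * d < q'"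
  shows "q dvd d"
proof -
  obtain m :: int where m: "\<bar>of_int d * \<omega> - of_int m\<bar> \<le> 1 / (4 * of_int q)"
    using near by (auto simp: near_int_def)
  have "of_int (d * p - m * q) = of_int q * (of_int d * \<omega> - of_int m) - of_int d * (of_int q * \<omega> - of_int p)"
    by (simp add: algebra_simps)
  hence "\<bar>of_int (d * p - m * q)\<bar> \<le> of_int q * \<bar>of_int d * \<omega> - of_int m\<bar> + of_int d * \<bar>of_int q * \<omega> - of_int p\<bar>"
    using abs_triangle_ineq4[of "of_int q * (of_int d * \<omega> - of_int m)" "of_int d * (of_int q * \<omega> - of_int p)"]
      q d by (simp add: abs_mult)
  also have "\<dots> \<le> of_int q * (1 / (4 * of_int q)) + of_int d * (1 / of_int q')"
    using m appr q d by (intro add_mono mult_left_mono) auto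
  also have "\<dots> < 1"
    using q d by (simp add: field_simps)
  finally have "d * p - m * q = 0"
    by linarith
  hence "q dvd d * p"
    by (metis dvd_triv_right eq_iff_diff_eq_0)
  thus ?thesis
    using cop by (metis coprime_commute coprime_dvd_mult_left_iff)
qed

context
  fixes \<omega> :: real and q q' :: int
  assumes q: "q \<ge> 1" and q': "q' \<ge> 1"
begin

lemma davie_weight_le:
  assumes le: "int m + int j * q \<le> int n"
  shows "(1 / of_int q + 4 / of_int q') * real m + real j \<le> (1 / of_int q + 4 / of_int q') * real n"
proof -
  let ?c = "1 / of_int q + 4 / of_int q' :: real"
  have c0: "?c \<ge> 0" and cq: "?c * of_int q \<ge> 1"
    using q q' by (auto simp: field_simps)
  have "real j \<le> ?c * (real j * of_int q)"
    using mult_left_mono[OF cq, of "real j"] by (simp add: mult_ac)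
  hence "?c * real m + real j \<le> ?c * real m + ?c * (real j * of_int q)"
    by simp
  also have "\<dots> = ?c * of_int (int m + int j * q)"
    by (simp add: algebra_simps)
  also have "\<dots> \<le> ?c * of_int (int n)"
    using le c0 by (intro mult_left_mono) (simp_all only: of_int_le_iff)
  finally show ?thesis by simp
qed

lemma davie_values_le:
  assumes "v \<in> davie_values \<omega> q q' n"
  shows "v \<le> (1 / of_int q + 4 / of_int q') * real n"
  using assms davie_weight_le unfolding davie_values_def by fastforce

lemma davie_valuesI:
  assumes "int m + int j * q \<le> int n"
    "t = 0 \<and> m = 0 \<or> t = 1 \<and> near_int (1 / (8 * of_int q)) (real m * \<omega>) \<or> t = 2"
  shows "(1 / of_int q + 4 / of_int q') * real m + real j - real t \<in> davie_values \<omega> q q' n"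
  using assms unfolding davie_values_def by blast

lemma davie_count_ge:
  assumes "int m + int j * q \<le> int n"
    "t = 0 \<and> m = 0 \<or> t = 1 \<and> near_int (1 / (8 * of_int q)) (real m * \<omega>) \<or> t = 2"
    "x \<le> (1 / of_int q + 4 / of_int q') * real m + real j - real t"
  shows "x \<le> davie_count \<omega> q q' n"
  unfolding davie_count_def
  by (rule order.trans[OF assms(3) cSup_upper[OF davie_valuesI[OF assms(1,2)]]])
     (auto intro!: bdd_aboveI davie_values_le)

lemma davie_count_leI:
  assumes "\<And>m j t. int m + int j * q \<le> int n \<Longrightarrow>
      t = 0 \<and> m = 0 \<or> t = 1 \<and> near_int (1 / (8 * of_int q)) (real m * \<omega>) \<or> t = 2 \<Longrightarrow>
      (1 / of_int q + 4 / of_int q') * real m + real j - real t \<le> x"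
  shows "davie_count \<omega> q q' n \<le> x"
  unfolding davie_count_def
proof (rule cSup_least)
  show "davie_values \<omega> q q' n \<noteq> {}"
    using davie_valuesI[of 0 0 n 0] by auto
qed (use assms in \<open>auto simp: davie_values_def\<close>)

lemma davie_count_nonneg: "0 \<le> davie_count \<omega> q q' n"
  by (rule davie_count_ge[of 0 0 n 0]) auto

lemma davie_count_le: "davie_count \<omega> q q' n \<le> (1 / of_int q + 4 / of_int q') * real n"
  by (rule davie_count_leI) (rule davie_values_le[OF davie_valuesI])

lemma davie_count_superadditive:
  "davie_count \<omega> q q' n1 + davie_count \<omega> q q' n2 \<le> davie_count \<omega> q q' (n1 + n2)"
proof -
  let ?c = "1 / of_int q + 4 / of_int q' :: real"
  let ?g = "davie_count \<omega> q q'"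
  have "?g n1 \<le> ?g (n1 + n2) - ?g n2"
  proof (rule davie_count_leI)
    fix m1 j1 t1 :: nat
    assume le1: "int m1 + int j1 * q \<le> int n1" and
      t1: "t1 = 0 \<and> m1 = 0 \<or> t1 = 1 \<and> near_int (1 / (8 * of_int q)) (real m1 * \<omega>) \<or> t1 = 2"
    have "?g n2 \<le> ?g (n1 + n2) - (?c * real m1 + real j1 - real t1)"
    proof (rule davie_count_leI)
      fix m2 j2 t2 :: nat
      assume le2: "int m2 + int j2 * q \<le> int n2" and
        t2: "t2 = 0 \<and> m2 = 0 \<or> t2 = 1 \<and> near_int (1 / (8 * of_int q)) (real m2 * \<omega>) \<or> t2 = 2"
      have "?c * real m1 + real j1 - real t1 + (?c * real m2 + real j2 - real t2) \<le> ?g (n1 + n2)"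
      proof (rule davie_count_ge[of "m1 + m2" "j1 + j2" _ "min 2 (t1 + t2)"])
        show "int (m1 + m2) + int (j1 + j2) * q \<le> int (n1 + n2)"
          using le1 le2 by (simp add: algebra_simps)
      qed (use t1 t2 in \<open>auto simp: algebra_simps add_divide_distrib\<close>)
      thus "?c * real m2 + real j2 - real t2 \<le> ?g (n1 + n2) - (?c * real m1 + real j1 - real t1)"
        by linarith
    qed
    thus "?c * real m1 + real j1 - real t1 \<le> ?g (n1 + n2) - ?g n2"
      by linarith
  qed
  thus ?thesis by linarith
qed

text \<open>
  Take a value $v = cm + j - t$ available at $n - 1$; a value at least $v + 1$ is needed at $n$. For
  $t = 2$ start afresh at $n \in A$ with level \<open>1\<close>. For $t \le 1$ both $m$ and $n$ lie in $A$. If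
  $q$ divides $n - m$, one more step of length $q$ fits between $m + jq$ and $n$. If not, then
  $n - m \ge q'/2$, and the summand $4/q'$ of $c$ has gained $2$ on the way, enough to start
  afresh at $n$ even when $t = 0$.
\<close>

lemma davie_count_jump:
  assumes cop: "coprime p q" and appr: "\<bar>of_int q * \<omega> - of_int p\<bar> \<le> 1 / of_int q'"
    and near: "near_int (1 / (8 * of_int q)) (real n * \<omega>)" and n: "n > 0"
  shows "davie_count \<omega> q q' (n - 1) + 1 \<le> davie_count \<omega> q q' n"
proof -
  let ?c = "1 / of_int q + 4 / of_int q' :: real"
  let ?g = "davie_count \<omega> q q'"
  have "?g (n - 1) \<le> ?g n - 1"
  proof (rule davie_count_leI)
    fix m j t :: nat
    assume le: "int m + int j * q \<le> int (n - 1)" and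
      t: "t = 0 \<and> m = 0 \<or> t = 1 \<and> near_int (1 / (8 * of_int q)) (real m * \<omega>) \<or> t = 2"
    have le': "int m + int j * q + 1 \<le> int n"
      using le n by simp
    have "?c * real m + real j - real t + 1 \<le> ?g n"
    proof (cases "t = 2")
      case True
      show ?thesis
      proof (rule davie_count_ge[of n 0 n 1])
        have "?c * real m + real j \<le> ?c * real n"
          using davie_weight_le[of m j n] le' by simp
        thus "?c * real m + real j - real t + 1 \<le> ?c * real n + real 0 - real 1"
          using True by simp
      qed (use near in auto)
    next
      case False
      define d where "d = int n - int m"
      have jd: "int j * q + 1 \<le> d"
        using le' by (simp add: d_def)
      moreover have "0 \<le> int j * q" using q by simp
      ultimately have d0: "d > 0" by linarith
      show ?thesis
      proof (cases "q dvd d")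
        case True
        then obtain k where k: "d = q * k" by blast
        have "int j * q < k * q" using jd k by (simp add: mult.commute)
        hence "int j < k" using q by simp
        show ?thesis
        proof (rule davie_count_ge[of m "nat k" n t])
          have "int j < k" by fact
          thus "int m + int (nat k) * q \<le> int n"
            using k by (simp add: d_def mult.commute)
          show "?c * real m + real j - real t + 1 \<le> ?c * real m + real (nat k) - real t"
            using \<open>int j < k\<close> by linarith
        qed (use t in auto)
      next
        case ndvd: False
        have "near_int (1 / (4 * of_int q)) (of_int d * \<omega>)"
        proof -
          obtain a :: int where a: "\<bar>real n * \<omega> - of_int a\<bar> \<le> 1 / (8 * of_int q)"
            using near by (auto simp: near_int_def)
          obtain b :: int where b: "\<bar>real m * \<omega> - of_int b\<bar> \<le> 1 / (8 * of_int q)"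
          proof (cases "t = 0")
            case True
            with t q that[of 0] show ?thesis by simp
          qed (use t False that in \<open>auto simp: near_int_def\<close>)
          have "of_int d * \<omega> - of_int (a - b) = (real n * \<omega> - of_int a) - (real m * \<omega> - of_int b)"
            by (simp add: d_def algebra_simps)
          hence "\<bar>of_int d * \<omega> - of_int (a - b)\<bar> \<le> 1 / (8 * of_int q) + 1 / (8 * of_int q)"
            using a b by linarith
          thus ?thesis unfolding near_int_def by (intro exI[of _ "a - b"]) simp
        qed
        hence "q' \<le> 2 * d"
          using near_int_imp_dvd[OF q q' cop appr, of d] ndvd d0 by linarith
        hence "(2::real) \<le> 4 / of_int q' * of_int d"
          using q' by (simp add: field_simps)
        moreover have "real j \<le> 1 / of_int q * of_int d"
        proof -
          have "real_of_int (int j * q) \<le> real_of_int d"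
            using jd by (simp only: of_int_le_iff)
          thus ?thesis using q by (simp add: field_simps)
        qed
        ultimately have "real j + 2 \<le> ?c * of_int d"
          by (simp add: distrib_right)
        hence 1: "?c * real m + real j + 2 \<le> ?c * real n"
          by (simp add: d_def algebra_simps diff_divide_distrib)
        show ?thesis
          by (rule davie_count_ge[of n 0 n 1]) (use near 1 in auto)
      qed
    qed
    thus "?c * real m + real j - real t \<le> ?g n - 1"
      by linarith
  qed
  thus ?thesis by linarith
qed

end

section \<open>Continued fraction convergents\<close>

text \<open>
  The index is shifted by 2, as for the denominators: this is $p_{m-2}$, with $p_{-2} = 0$ and
  $p_{-1} = 1$.
\<close>

fun cf_numer_aux :: "real \<Rightarrow> nat \<Rightarrow> int" where
  "cf_numer_aux \<omega> 0 = 0"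
| "cf_numer_aux \<omega> (Suc 0) = 1"
| "cf_numer_aux \<omega> (Suc (Suc n)) =
     cf_coeff \<omega> n * cf_numer_aux \<omega> (Suc n) + cf_numer_aux \<omega> n"

lemma cf_determinant:
  "cf_numer_aux \<omega> (Suc n) * cf_denom_aux \<omega> n - cf_numer_aux \<omega> n * cf_denom_aux \<omega> (Suc n) = (-1) ^ n"
proof (induction n)
  case (Suc n)
  have "cf_numer_aux \<omega> (Suc (Suc n)) * cf_denom_aux \<omega> (Suc n) - cf_numer_aux \<omega> (Suc n) * cf_denom_aux \<omega> (Suc (Suc n))
      = - (cf_numer_aux \<omega> (Suc n) * cf_denom_aux \<omega> n - cf_numer_aux \<omega> n * cf_denom_aux \<omega> (Suc n))"
    by (simp add: algebra_simps del: cf_coeff.simps)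
  thus ?case using Suc by simp
qed simp

context
  fixes \<omega> :: real
  assumes irr: "\<omega> \<notin> \<rat>"
begin

text \<open>
  In terms of convergents, $q_n \omega - p_n = - \omega_n (q_{n-1} \omega - p_{n-1})$. The induction
  step is the recursion $\omega_{n+1} = 1/\omega_n - a_{n+1}$.
\<close>

lemma cf_error_step:
  "of_int (cf_denom_aux \<omega> (Suc (Suc n))) * \<omega> - of_int (cf_numer_aux \<omega> (Suc (Suc n)))
    = - cf_rem \<omega> n * (of_int (cf_denom_aux \<omega> (Suc n)) * \<omega> - of_int (cf_numer_aux \<omega> (Suc n)))"
proof (induction n)
  case (Suc n)
  define e where "e = (\<lambda>n. of_int (cf_denom_aux \<omega> n) * \<omega> - of_int (cf_numer_aux \<omega> n))"
  have IH: "e (Suc (Suc n)) = - cf_rem \<omega> n * e (Suc n)"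
    using Suc by (simp only: e_def)
  have "e (Suc (Suc (Suc n))) = of_int (cf_coeff \<omega> (Suc n)) * e (Suc (Suc n)) + e (Suc n)"
    by (simp add: e_def algebra_simps del: cf_coeff.simps)
  also have "e (Suc n) = - e (Suc (Suc n)) / cf_rem \<omega> n"
    using IH cf_rem_bounds[OF irr, of n] by simp
  also have "of_int (cf_coeff \<omega> (Suc n)) * e (Suc (Suc n)) + (- e (Suc (Suc n)) / cf_rem \<omega> n)
      = - cf_rem \<omega> (Suc n) * e (Suc (Suc n))"
    by (simp add: algebra_simps)
  finally show ?case by (simp only: e_def)
qed simp

text \<open>
  With $e_k = q_k \omega - p_k$, the determinant identity reads
  $\pm 1 = e_k q_{k+1} - q_k e_{k+1} = e_k (q_{k+1} + q_k \omega_{k+1})$.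
\<close>

lemma cf_denom_approx:
  "\<exists>p. coprime p (cf_denom \<omega> k) \<and>
     \<bar>of_int (cf_denom \<omega> k) * \<omega> - of_int p\<bar> \<le> 1 / of_int (cf_denom \<omega> (Suc k))"
proof -
  define q where "q = cf_denom \<omega> k"
  define q' where "q' = cf_denom \<omega> (Suc k)"
  define p where "p = cf_numer_aux \<omega> (k + 2)"
  define p' where "p' = cf_numer_aux \<omega> (Suc k + 2)"
  have q: "q \<ge> 1" "q' \<ge> 1"
    using cf_denom_ge_1[OF irr] by (simp_all add: q_def q'_def)
  have det: "p' * q - p * q' = (-1) ^ k"
    using cf_determinant[of \<omega> "k + 2"] by (simp add: p_def p'_def q_def q'_def cf_denom_def del: cf_denom_aux.simps cf_numer_aux.simps)
  have "is_unit ((-1::int) ^ k)"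
    by (simp add: is_unit_power_iff)
  hence "coprime p q"
    unfolding det[symmetric] coprime_def by (meson dvd_diff dvd_mult dvd_mult2 dvd_trans)
  have step: "of_int q' * \<omega> - of_int p' = - cf_rem \<omega> (Suc k) * (of_int q * \<omega> - of_int p)"
    using cf_error_step[of "Suc k"] by (simp add: p_def p'_def q_def q'_def cf_denom_def del: cf_denom_aux.simps cf_numer_aux.simps cf_rem.simps)
  have "(-1) ^ k = real_of_int (p' * q - p * q')"
    by (simp add: det)
  also have "\<dots> = of_int q' * (of_int q * \<omega> - of_int p) - of_int q * (of_int q' * \<omega> - of_int p')"
    by (simp add: algebra_simps)
  also have "\<dots> = (of_int q * \<omega> - of_int p) * (of_int q' + of_int q * cf_rem \<omega> (Suc k))"
    unfolding step by (simp add: algebra_simps)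
  finally have "1 = \<bar>of_int q * \<omega> - of_int p\<bar> * \<bar>of_int q' + of_int q * cf_rem \<omega> (Suc k)\<bar>"
    by (metis abs_mult power_abs abs_minus_cancel abs_one power_one)
  moreover have "of_int q' \<le> \<bar>of_int q' + of_int q * cf_rem \<omega> (Suc k)\<bar>"
    using q cf_rem_bounds[OF irr, of "Suc k"] mult_nonneg_nonneg[of "real_of_int q" "cf_rem \<omega> (Suc k)"] by linarith
  ultimately have "\<bar>of_int q * \<omega> - of_int p\<bar> * of_int q' \<le> 1"
    by (metis abs_ge_zero mult_left_mono)
  hence "\<bar>of_int q * \<omega> - of_int p\<bar> \<le> 1 / of_int q'"
    using q by (simp add: field_simps)
  with \<open>coprime p q\<close> show ?thesis
    by (auto simp: q_def q'_def)
qed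

lemma cf_denom_add_le: "cf_denom \<omega> (Suc k) + cf_denom \<omega> k \<le> cf_denom \<omega> (Suc (Suc k))"
proof -
  have "cf_coeff \<omega> (Suc (Suc k)) \<ge> 1"
    using cf_rem_bounds[OF irr, of "Suc k"] by (simp add: le_floor_iff field_simps del: cf_rem.simps)
  hence "1 * cf_denom \<omega> (Suc k) \<le> cf_coeff \<omega> (Suc (Suc k)) * cf_denom \<omega> (Suc k)"
    using cf_denom_ge_1[OF irr, of "Suc k"] by (intro mult_right_mono) auto
  thus ?thesis by (simp add: cf_denom_def del: cf_coeff.simps)
qed

lemma cf_denom_mono: "cf_denom \<omega> k \<le> cf_denom \<omega> (Suc k)"
proof (cases k)
  case 0
  thus ?thesis using cf_denom_ge_1[OF irr, of 1] by (simp add: cf_denom_def numeral_2_eq_2)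
next
  case (Suc j)
  thus ?thesis using cf_denom_add_le[of j] cf_denom_ge_1[OF irr, of j] by simp
qed

lemma cf_denom_growth: "2 ^ k \<le> 2 * (cf_denom \<omega> k)\<^sup>2"
proof (induction k rule: induct_nat_012)
  case (ge2 k)
  have "2 * cf_denom \<omega> k \<le> cf_denom \<omega> (Suc (Suc k))"
    using cf_denom_add_le[of k] cf_denom_mono[of k] by simp
  hence "(2 * cf_denom \<omega> k)\<^sup>2 \<le> (cf_denom \<omega> (Suc (Suc k)))\<^sup>2"
    using cf_denom_ge_1[OF irr, of k] by (intro power_mono) auto
  thus ?case using ge2 by (simp add: power_mult_distrib)
next
  case 0
  show ?case using one_le_power[OF cf_denom_ge_1[OF irr], of 0 2] by simp
next
  case 1
  show ?case using one_le_power[OF cf_denom_ge_1[OF irr], of 1 2] by simp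
qed

text \<open>
  Since $q_{k+2} \ge 2 q_k$, the denominators grow at least like $2^{k/2}$. The square root is used
  because it absorbs logarithms: $\log q \le 2 \sqrt q$, so $\log q / q$ is a multiple of
  $1/\sqrt q$ at most.
\<close>

lemma inverse_sqrt_cf_denom_le:
  "1 / sqrt (of_int (cf_denom \<omega> k)) \<le> 2 * (2 powr (-1/4)) ^ k"
proof -
  define x where "x = 1 / sqrt (of_int (cf_denom \<omega> k))"
  define s :: real where "s = 2 powr (-1/4)"
  have q: "real_of_int (cf_denom \<omega> k) \<ge> 1"
    using cf_denom_ge_1[OF irr, of k] by simp
  have s4: "s ^ 4 = 1 / 2"
    by (simp add: s_def powr_power)
  have "real_of_int (2 ^ k) \<le> real_of_int (2 * (cf_denom \<omega> k)\<^sup>2)"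
    using cf_denom_growth by (simp only: of_int_le_iff)
  hence "1 / real_of_int (cf_denom \<omega> k) ^ 2 \<le> 2 * (1/2) ^ k"
    using q by (simp add: field_simps)
  moreover have "x ^ 4 = 1 / real_of_int (cf_denom \<omega> k) ^ 2"
  proof -
    have "x ^ 4 = (x\<^sup>2)\<^sup>2" by simp
    also have "x\<^sup>2 = 1 / real_of_int (cf_denom \<omega> k)"
      using q by (simp add: x_def power_divide)
    finally show ?thesis by (simp add: power_divide)
  qed
  moreover have "(2 * s ^ k) ^ 4 = 16 * (1/2) ^ k"
    by (simp add: power_mult_distrib s4 flip: power_mult) (simp add: power_mult mult.commute[of k] s4)
  moreover have "(0::real) \<le> (1/2) ^ k"
    by simp
  ultimately have "x ^ 4 \<le> (2 * s ^ k) ^ 4"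
    by linarith
  thus ?thesis
    unfolding x_def[symmetric] s_def[symmetric]
    by (rule power_le_imp_le_base[of _ 3, simplified]) (simp add: s_def)
qed

end

section \<open>The weight attached to the Brjuno function\<close>

text \<open>
  With \<open>y\<close> the signed distance of $n\omega$ to the nearest integer,
  $|\lambda^n - 1| = 2 \sin (\pi |y|)$. The sine is increasing on $[0, \pi/2]$, and for
  $\delta \le 1/8$ its cubic Taylor estimate gives $\sin (\pi \delta) \ge 2 \delta$.
\<close>

lemma norm_multiplier_power_minus_one:
  assumes far: "\<not> near_int \<delta> (real n * \<omega>)" and \<delta>: "0 \<le> \<delta>" "\<delta> \<le> 1 / 8"
  shows "4 * \<delta> \<le> cmod (multiplier \<omega> ^ n - 1)"
proof -
  define m where "m = round (real n * \<omega>)"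
  define y where "y = real n * \<omega> - of_int m"
  have y: "\<delta> \<le> \<bar>y\<bar>" "\<bar>y\<bar> \<le> 1 / 2"
  proof -
    show "\<delta> \<le> \<bar>y\<bar>"
      using far unfolding near_int_def y_def by (meson linear)
    show "\<bar>y\<bar> \<le> 1 / 2"
      using of_int_round_abs_le[of "real n * \<omega>"] by (simp add: y_def m_def abs_minus_commute)
  qed
  have "multiplier \<omega> ^ n = exp (\<i> * of_real (2 * pi * (real n * \<omega>)))"
    unfolding multiplier_def by (simp add: mult_ac flip: exp_of_nat_mult)
  hence "cmod (multiplier \<omega> ^ n - 1) = 2 * \<bar>sin (pi * (real n * \<omega>))\<bar>"
    using dist_exp_i_1[of "2 * pi * (real n * \<omega>)"] by (simp add: mult_ac)
  also have "pi * (real n * \<omega>) = pi * y + pi * of_int m"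
    by (simp add: y_def algebra_simps)
  also have "\<bar>sin (pi * y + pi * of_int m)\<bar> = \<bar>sin (pi * y)\<bar>"
    by (simp add: sin_add cos_npi_int sin_npi_int abs_mult)
  also have "\<dots> = sin (pi * \<bar>y\<bar>)"
  proof -
    have "0 \<le> sin (pi * \<bar>y\<bar>)"
      using y by (intro sin_ge_zero) auto
    thus ?thesis by (cases "y \<ge> 0") auto
  qed
  finally have "cmod (multiplier \<omega> ^ n - 1) = 2 * sin (pi * \<bar>y\<bar>)" .
  moreover have "sin (pi * \<delta>) \<le> sin (pi * \<bar>y\<bar>)"
    using y \<delta> by (intro sin_monotone_2pi_le) (auto intro: order.trans[of _ 0])
  moreover have "2 * \<delta> \<le> sin (pi * \<delta>)"
  proof -
    have "\<bar>sin (pi * \<delta>) - pi * \<delta>\<bar> \<le> (pi * \<delta>) ^ 3 / 6"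
      using Maclaurin_sin_bound[of "pi * \<delta>" 3] \<delta>
      by (simp add: numeral_3_eq_3 sin_coeff_def fact_numeral field_simps)
    moreover have "(pi * \<delta>) ^ 3 \<le> pi * \<delta>"
    proof -
      have "pi * \<delta> \<le> 4 * (1 / 8)"
        using \<delta> pi_less_4 by (intro mult_mono) auto
      thus ?thesis
        using power_decreasing[of 1 3 "pi * \<delta>"] \<delta> by simp
    qed
    ultimately have "pi * \<delta> * (5 / 6) \<le> sin (pi * \<delta>)"
      by linarith
    moreover have "2 * \<delta> \<le> pi * \<delta> * (5 / 6)"
      using mult_right_mono[of "12 / 5" pi \<delta>] \<delta> pi_gt3 by simp
    ultimately show ?thesis by linarith
  qed
  ultimately show ?thesis by linarith
qed

text \<open>
  One summand of the bound for $K(n)/n$ is compared with the corresponding summand of the Brjuno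
  function. The difference, $\log 2 / q_k + 4 \log(2 q_{k+1}) / q_{k+1}$, decays geometrically in $k$ at a rate that
  does not depend on $\omega$.
\<close>

lemma cf_weight_le:
  fixes \<omega> :: real and k :: nat
  defines "q \<equiv> real_of_int (cf_denom \<omega> k)" and "Q \<equiv> real_of_int (cf_denom \<omega> (Suc k))"
  assumes irr: "\<omega> \<notin> \<rat>"
  shows "(1 / q + 4 / Q) * ln (2 * Q) \<le> ln Q / q + 18 * (2 powr (-1/4)) ^ k"
proof -
  define s :: real where "s = 2 powr (-1/4)"
  have s: "0 < s" "s < 1"
    using powr_less_mono[of "-1/4" 0 "2::real"] by (simp_all add: s_def)
  have q: "q \<ge> 1" and Q: "Q \<ge> 1"
    using cf_denom_ge_1[OF irr] by (simp_all add: q_def Q_def)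
  have log_split: "ln (2 * Q) = ln 2 + ln Q"
    using Q by (simp add: ln_mult)
  have "ln 2 / q \<le> 1 / sqrt q"
    using q ln_2_less_1 real_sqrt_ge_one[OF q]
    by (intro frac_le) (auto intro!: real_le_lsqrt simp: power2_eq_square)
  also have "\<dots> \<le> 2 * s ^ k"
    unfolding q_def s_def by (rule inverse_sqrt_cf_denom_le[OF irr])
  finally have 1: "1 / q * ln (2 * Q) \<le> ln Q / q + 2 * s ^ k"
    unfolding log_split by (simp add: add_divide_distrib)
  have "ln (2 * Q) = ln 2 + 2 * ln (sqrt Q)"
    using Q by (simp add: log_split ln_sqrt)
  also have "\<dots> \<le> 1 + 2 * (sqrt Q - 1)"
    using ln_2_less_1 ln_le_minus_one[of "sqrt Q"] Q by simp
  finally have "ln (2 * Q) \<le> 2 * sqrt Q" by simp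
  hence "4 / Q * ln (2 * Q) \<le> 4 / Q * (2 * sqrt Q)"
    using Q by (intro mult_left_mono) auto
  also have "\<dots> = 8 * (1 / sqrt Q)"
    using Q by (simp add: field_simps)
  also have "\<dots> \<le> 8 * (2 * s ^ Suc k)"
    unfolding Q_def s_def by (intro mult_left_mono inverse_sqrt_cf_denom_le[OF irr]) auto
  also have "\<dots> \<le> 16 * s ^ k"
    using s by (simp add: mult_left_le_one_le)
  finally show ?thesis
    using 1 by (simp add: s_def distrib_right)
qed

lemma eventually_far_from_int:
  assumes irr: "\<omega> \<notin> \<rat>" and n: "n \<ge> 1"
  shows "\<exists>k. \<not> near_int (1 / (8 * of_int (cf_denom \<omega> k))) (real n * \<omega>)"
proof (rule ccontr)
  assume "\<not> ?thesis"
  hence near: "near_int (1 / (8 * of_int (cf_denom \<omega> k))) (real n * \<omega>)" for k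
    by auto
  define s :: real where "s = 2 powr (-1/4)"
  have s: "s < 1"
    using powr_less_mono[of "-1/4" 0 "2::real"] by (simp add: s_def)
  define \<epsilon> where "\<epsilon> = \<bar>real n * \<omega> - of_int (round (real n * \<omega>))\<bar>"
  have "\<epsilon> > 0"
  proof (rule ccontr)
    assume "\<not> \<epsilon> > 0"
    hence "\<omega> = of_int (round (real n * \<omega>)) / of_nat n"
      using n by (simp add: \<epsilon>_def field_simps)
    thus False
      using irr by (metis Rats_divide Rats_of_int Rats_of_nat)
  qed
  then obtain k where k: "s ^ k < \<epsilon> / 2"
    using real_arch_pow_inv[of "\<epsilon> / 2" s] s by auto
  have q: "real_of_int (cf_denom \<omega> k) \<ge> 1"
    using cf_denom_ge_1[OF irr, of k] by simp
  obtain m :: int where "\<bar>real n * \<omega> - of_int m\<bar> \<le> 1 / (8 * of_int (cf_denom \<omega> k))"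
    using near[of k] by (auto simp: near_int_def)
  hence "\<epsilon> \<le> 1 / (8 * of_int (cf_denom \<omega> k))"
    using round_diff_minimal[of "real n * \<omega>" m] by (simp add: \<epsilon>_def)
  also have "\<dots> \<le> 1 / sqrt (of_int (cf_denom \<omega> k))"
    using q by (intro frac_le) (auto intro!: real_le_lsqrt simp: power2_eq_square)
  also have "\<dots> \<le> 2 * s ^ k"
    unfolding s_def by (rule inverse_sqrt_cf_denom_le[OF irr])
  finally show False using k by simp
qed

text \<open>
  The sum over $k$ of the error terms $18 \cdot 2^{-k/4}$ of \<open>cf_weight_le\<close>.
\<close>

definition excess_bound :: real where
  "excess_bound = 18 / (1 - 2 powr (-1/4))"

text \<open>
  The weight is $K(n) = n \log 2 + \sum_k g_k(n) \log(2 q_{k+1})$. Its growth from $n - 1$ to $n$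
  has to compensate $|\lambda^n - 1|$. Let $k$ be the least index for which $n\omega$ is farther than
  $1/(8 q_k)$ from the integers; then $|\lambda^n - 1| \ge 1/(2 q_k)$. If $k = 0$, this is $1/2$ and
  the term $n \log 2$ suffices. Otherwise $n\omega$ is near an integer at the scale $k - 1$, and the
  jump of $g_{k-1}$ contributes $\log(2 q_k)$.
\<close>

lemma brjuno_weight_exists:
  fixes \<omega> :: real
  assumes irr: "\<omega> \<notin> \<rat>" and B: "brjuno \<omega> = ereal B"
  obtains K :: "nat \<Rightarrow> real" where "K 0 = 0" "\<And>n. K n \<ge> 0" "\<And>m n. K m + K n \<le> K (m + n)"
    "\<And>n. n \<ge> 1 \<Longrightarrow> exp (K (n - 1)) \<le> exp (K n) * cmod (multiplier \<omega> ^ n - 1)"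
    "\<And>n. K n \<le> real n * (ln 2 + B + excess_bound)"
proof -
  define q where "q = cf_denom \<omega>"
  have q1: "q k \<ge> 1" for k
    using cf_denom_ge_1[OF irr] by (simp add: q_def)
  hence q1': "real_of_int (q k) \<ge> 1" for k
    by simp
  define s :: real where "s = 2 powr (-1/4)"
  have s: "0 < s" "s < 1"
    using powr_less_mono[of "-1/4" 0 "2::real"] by (simp_all add: s_def)
  define w where "w = (\<lambda>k. ln (2 * real_of_int (q (Suc k))))"
  have w0: "w k \<ge> 0" for k
    using q1'[of "Suc k"] by (simp add: w_def)
  define c where "c = (\<lambda>k. 1 / real_of_int (q k) + 4 / real_of_int (q (Suc k)))"
  define b where "b = (\<lambda>k. ln (real_of_int (q (Suc k))) / real_of_int (q k))"
  have b0: "b k \<ge> 0" for k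
    using q1'[of k] q1'[of "Suc k"] by (simp add: b_def)
  have "(\<lambda>k. ereal (b k)) sums (\<Sum>k. ereal (b k))"
    using b0 by (intro summable_sums summable_ereal_pos) simp
  moreover have "(\<Sum>k. ereal (b k)) = ereal B"
    using B by (simp add: brjuno_def b_def q_def)
  ultimately have b_sums: "b sums B"
    by (simp add: sums_ereal)
  have cw: "c k * w k \<le> b k + 18 * s ^ k" for k
    unfolding c_def w_def b_def s_def q_def by (rule cf_weight_le[OF irr])
  have major_sums: "(\<lambda>k. b k + 18 * s ^ k) sums (B + excess_bound)"
    unfolding excess_bound_def s_def[symmetric]
    using sums_add[OF b_sums sums_mult[OF geometric_sums[of s], of 18]] s by simp
  define G where "G = (\<lambda>k n. davie_count \<omega> (q k) (q (Suc k)) n)"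
  have G0: "G k n \<ge> 0" for k n
    unfolding G_def by (rule davie_count_nonneg[OF q1 q1])
  have Gle: "G k n \<le> c k * real n" for k n
    unfolding G_def c_def by (rule davie_count_le[OF q1 q1])
  have Gadd: "G k m + G k n \<le> G k (m + n)" for k m n
    unfolding G_def by (rule davie_count_superadditive[OF q1 q1])
  have Gw_le: "G k n * w k \<le> real n * (b k + 18 * s ^ k)" for k n
  proof -
    have "G k n * w k \<le> real n * (c k * w k)"
      using mult_right_mono[OF Gle w0] by (simp add: mult_ac)
    also have "\<dots> \<le> real n * (b k + 18 * s ^ k)"
      by (intro mult_left_mono cw) auto
    finally show ?thesis .
  qed
  have Gw_summable: "summable (\<lambda>k. G k n * w k)" for n
    by (rule summable_comparison_test'[OF sums_summable[OF sums_mult[OF major_sums]]])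
       (use Gw_le G0 w0 in auto)
  define K where "K = (\<lambda>n. real n * ln 2 + (\<Sum>k. G k n * w k))"
  show thesis
  proof (rule that)
    have "G k 0 = 0" for k
      using Gle[of k 0] G0[of k 0] by simp
    thus "K 0 = 0"
      by (simp add: K_def)
    show "K n \<ge> 0" for n
      unfolding K_def by (intro add_nonneg_nonneg suminf_nonneg Gw_summable mult_nonneg_nonneg G0 w0) auto
    show super: "K m + K n \<le> K (m + n)" for m n
    proof -
      have "(\<Sum>k. G k m * w k) + (\<Sum>k. G k n * w k) = (\<Sum>k. G k m * w k + G k n * w k)"
        by (rule suminf_add[OF Gw_summable Gw_summable])
      also have "\<dots> \<le> (\<Sum>k. G k (m + n) * w k)"
        using mult_right_mono[OF Gadd w0]
        by (intro suminf_le summable_add Gw_summable) (simp add: distrib_right)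
      finally show ?thesis by (simp add: K_def algebra_simps)
    qed
    show "K n \<le> real n * (ln 2 + B + excess_bound)" for n
    proof -
      have "(\<Sum>k. G k n * w k) \<le> real n * (B + excess_bound)"
        using suminf_le[OF Gw_le Gw_summable sums_summable[OF sums_mult[OF major_sums]]]
          sums_unique[OF sums_mult[OF major_sums, of "real n"]] by simp
      thus ?thesis by (simp add: K_def algebra_simps)
    qed
    fix n :: nat assume n: "n \<ge> 1"
    define far where "far = (\<lambda>k. \<not> near_int (1 / (8 * of_int (q k))) (real n * \<omega>))"
    have "\<exists>k. far k"
      unfolding far_def q_def by (rule eventually_far_from_int[OF irr n])
    define k where "k = (LEAST k. far k)"
    have "far k"
      unfolding k_def using \<open>\<exists>k. far k\<close> by (rule LeastI_ex)
    have dist: "1 / (2 * of_int (q k)) \<le> cmod (multiplier \<omega> ^ n - 1)"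
      using norm_multiplier_power_minus_one[OF \<open>far k\<close>[unfolded far_def]] q1'[of k]
      by (simp add: field_simps)
    have gain: "K (n - 1) + ln (2 * of_int (q k)) \<le> K n"
    proof -
      have mono: "G j (n - 1) * w j \<le> G j n * w j" for j
      proof -
        have "G j (n - 1) \<le> G j n"
          using Gadd[of j "n - 1" 1] G0[of j 1] n by simp
        thus ?thesis by (intro mult_right_mono w0)
      qed
      have K_diff: "K n - K (n - 1) = ln 2 + (\<Sum>j. G j n * w j - G j (n - 1) * w j)"
        unfolding suminf_diff[OF Gw_summable Gw_summable, symmetric]
        using n by (simp add: K_def of_nat_diff algebra_simps)
      have diff_summable: "summable (\<lambda>j. G j n * w j - G j (n - 1) * w j)"
        by (intro summable_diff Gw_summable)
      show ?thesis
      proof (cases k)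
        case 0
        have "q 0 = 1" by (simp add: q_def cf_denom_def numeral_2_eq_2)
        moreover have "0 \<le> (\<Sum>j. G j n * w j - G j (n - 1) * w j)"
          using mono by (intro suminf_nonneg diff_summable) simp
        ultimately show ?thesis using K_diff 0 by simp
      next
        case (Suc i)
        hence "near_int (1 / (8 * of_int (q i))) (real n * \<omega>)"
          using not_less_Least[of i far] by (auto simp: k_def far_def)
        moreover obtain p where "coprime p (q i)" "\<bar>of_int (q i) * \<omega> - of_int p\<bar> \<le> 1 / of_int (q (Suc i))"
          using cf_denom_approx[OF irr, of i] by (auto simp: q_def)
        ultimately have "G i (n - 1) + 1 \<le> G i n"
          unfolding G_def using n by (intro davie_count_jump[OF q1 q1]) auto
        hence "w i * 1 \<le> w i * (G i n - G i (n - 1))"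
          by (intro mult_left_mono w0) simp
        hence "w i \<le> (\<Sum>j\<in>{i}. G j n * w j - G j (n - 1) * w j)"
          by (simp add: algebra_simps)
        also have "\<dots> \<le> (\<Sum>j. G j n * w j - G j (n - 1) * w j)"
          using mono by (intro sum_le_suminf diff_summable) auto
        finally have "K (n - 1) + ln 2 + w i \<le> K n"
          using K_diff by linarith
        moreover have "w i = ln (2 * of_int (q k))" "0 \<le> ln (2::real)"
          by (simp_all add: w_def Suc)
        ultimately show ?thesis by linarith
      qed
    qed
    have "exp (K (n - 1)) * (2 * of_int (q k)) = exp (K (n - 1) + ln (2 * of_int (q k)))"
      using q1'[of k] by (simp add: exp_add)
    also have "\<dots> \<le> exp (K n)"
      using gain by simp
    finally have "exp (K (n - 1)) \<le> exp (K n) * (1 / (2 * of_int (q k)))"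
      using q1'[of k] by (simp add: field_simps)
    also have "\<dots> \<le> exp (K n) * cmod (multiplier \<omega> ^ n - 1)"
      by (intro mult_left_mono dist) auto
    finally show "exp (K (n - 1)) \<le> exp (K n) * cmod (multiplier \<omega> ^ n - 1)" .
  qed
qed

section \<open>The radius of convergence\<close>

lemma conv_radius_ge_of_coeff_bound:
  fixes H :: "complex fps"
  assumes M: "M > 0" and bound: "\<And>n. cmod (fps_nth H (Suc n)) \<le> A * M ^ n"
  shows "ereal (1 / M) \<le> fps_conv_radius H"
  unfolding fps_conv_radius_def
proof (rule conv_radius_geI_ex')
  fix r :: real assume r: "0 < r" "ereal r < ereal (1 / M)"
  hence "r * M < 1"
    using M by (simp add: field_simps)
  have "summable (\<lambda>n. A * r * (r * M) ^ n)"
    using r M \<open>r * M < 1\<close> by (intro summable_mult summable_geometric) simp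
  moreover have "norm (fps_nth H (Suc n) * of_real r ^ Suc n) \<le> A * r * (r * M) ^ n" for n
    using mult_right_mono[OF bound[of n], of "r ^ Suc n"] r
    by (simp add: norm_mult norm_power power_mult_distrib mult_ac)
  ultimately have "summable (\<lambda>n. fps_nth H (Suc n) * of_real r ^ Suc n)"
    by (rule summable_comparison_test')
  thus "summable (\<lambda>n. fps_nth H n * of_real r ^ n)"
    by (subst (asm) summable_Suc_iff)
qed

text \<open>
  The factor $64$ collects the radius $1/(8b)$ of the majorant argument with
  \<open>b = 4 * univalent_bound\<close>, and the factor $2$ that comes from the term $n \log 2$ of the weight.
\<close>

lemma lin_radius_ge:
  assumes irr: "\<omega> \<notin> \<rat>" and B: "brjuno \<omega> = ereal B" and F: "F \<in> univalent_class (multiplier \<omega>)"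
  shows "ereal (exp (- B - (ln (64 * univalent_bound) + excess_bound))) \<le> lin_radius (multiplier \<omega>) F"
proof -
  define l where "l = multiplier \<omega>"
  define b where "b = 4 * univalent_bound"
  have ub: "univalent_bound \<ge> 1" by (simp add: univalent_bound_def)
  hence b: "b > 0" by (simp add: b_def)
  have l: "cmod l = 1"
    by (simp add: l_def multiplier_def)
  have F': "F holomorphic_on ball 0 1" "inj_on F (ball 0 1)" "F 0 = 0" "deriv F 0 = l"
    using F by (auto simp: univalent_class_def l_def analytic_imp_holomorphic)
  have coeff: "cmod (fps_nth (fps_expansion F 0) (Suc j)) \<le> b ^ j" if "j \<ge> 1" for j
  proof -
    have "cmod (fps_nth (fps_expansion F 0) (Suc j)) \<le> univalent_bound * 2 ^ Suc j"
      by (rule univalent_coeff_bound[OF F'(1-3)]) (simp add: F'(4) l)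
    also have "\<dots> \<le> univalent_bound ^ j * 4 ^ j"
    proof (intro mult_mono)
      show "univalent_bound \<le> univalent_bound ^ j"
        using power_increasing[OF that ub] by simp
      have "(2::real) ^ Suc j \<le> 2 ^ (2 * j)"
        using that by (intro power_increasing) auto
      thus "(2::real) ^ Suc j \<le> 4 ^ j"
        by (simp add: power_mult)
    qed (use ub in auto)
    finally show ?thesis
      by (simp add: b_def power_mult_distrib mult_ac)
  qed
  obtain K where K: "K 0 = 0" "\<And>n. K n \<ge> 0" "\<And>m n. K m + K n \<le> K (m + n)"
    "\<And>n. n \<ge> 1 \<Longrightarrow> exp (K (n - 1)) \<le> exp (K n) * cmod (l ^ n - 1)"
    "\<And>n. K n \<le> real n * (ln 2 + B + excess_bound)"
    using brjuno_weight_exists[OF irr B] unfolding l_def by metis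
  define M where "M = 8 * b * exp (ln 2 + B + excess_bound)"
  have M: "M > 0" using b by (simp add: M_def)
  have "cmod (fps_nth (linearization l F) (Suc n)) \<le> 2 * M ^ n" for n
  proof -
    have "cmod (fps_nth (linearization l F) (Suc n)) \<le> 2 * (8 * b) ^ n * exp (K n)"
    proof (rule linearization_coeff_bound)
      show "linearizes l (fps_expansion F 0) (linearization l F)"
        unfolding l_def by (rule linearizes_linearization[OF irr F])
      show "fps_nth (fps_expansion F 0) 0 = 0" "fps_nth (fps_expansion F 0) 1 = l"
        using F' by (simp_all add: fps_expansion_def)
    qed (use K coeff l b in auto)
    also have "\<dots> \<le> 2 * (8 * b) ^ n * exp (real n * (ln 2 + B + excess_bound))"
      using K(5)[of n] b by (intro mult_left_mono) auto
    also have "\<dots> = 2 * M ^ n"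
      by (simp add: M_def power_mult_distrib flip: exp_of_nat_mult)
    finally show ?thesis .
  qed
  hence "ereal (1 / M) \<le> lin_radius l F"
    unfolding lin_radius_def by (rule conv_radius_ge_of_coeff_bound[OF M])
  moreover have "exp (- B - (ln (64 * univalent_bound) + excess_bound)) = 1 / M"
    using ub by (simp add: M_def b_def exp_add exp_diff exp_minus field_simps)
  ultimately show ?thesis by (simp add: l_def)
qed

lemma ereal_log_ge:
  assumes "ereal (exp x) \<le> r"
  shows "ereal x \<le> ereal_log r"
proof (cases r)
  case (real y)
  hence "exp x \<le> y" using assms by simp
  moreover have "0 < y" using \<open>exp x \<le> y\<close> exp_gt_zero[of x] by linarith
  ultimately show ?thesis using real by (simp add: ereal_log_def ln_ge_iff)
qed (use assms in \<open>auto simp: ereal_log_def\<close>)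

theorem theorem2p1:
  shows "\<exists>C::real. \<forall>\<omega>::real. \<omega> \<notin> \<rat> \<longrightarrow>
           ereal_log (inf_lin_radius \<omega>) \<ge> - brjuno \<omega> - ereal C"
proof (intro exI[of _ "ln (64 * univalent_bound) + excess_bound"] allI impI)
  fix \<omega> :: real assume irr: "\<omega> \<notin> \<rat>"
  show "ereal_log (inf_lin_radius \<omega>) \<ge> - brjuno \<omega> - ereal (ln (64 * univalent_bound) + excess_bound)"
  proof (cases "brjuno \<omega>")
    case (real B)
    have "ereal (exp (- B - (ln (64 * univalent_bound) + excess_bound))) \<le> inf_lin_radius \<omega>"
      unfolding inf_lin_radius_def by (intro INF_greatest lin_radius_ge irr real)
    from ereal_log_ge[OF this] show ?thesis by (simp add: real)
  next
    case MInf
    have "real_of_int (cf_denom \<omega> n) \<ge> 1" for n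
      using cf_denom_ge_1[OF irr, of n] by simp
    hence "0 \<le> ln (real_of_int (cf_denom \<omega> (n + 1))) / real_of_int (cf_denom \<omega> n)" for n
      by (intro divide_nonneg_nonneg ln_ge_zero) (auto intro: order.trans[OF zero_le_one])
    hence "brjuno \<omega> \<ge> 0"
      unfolding brjuno_def by (intro suminf_nonneg summable_ereal_pos) auto
    thus ?thesis using MInf by simp
  qed simp
qed

end
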